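(* If $G$ is a $2$-tree with maximum degree $\Delta(G)\ge 3$, then $\mu_{\mathrm{int}}(G)\le \left\lceil \frac{\Delta(G)}{3}\right\rceil$.
   Context: Graphs are finite and simple. A $2$-tree is a graph obtained from $K_3$ by repeatedly (zero or more times) adding a new vertex $v$ adjacent to exactly two existing vertices, where these two vertices are adjacent to each other. An improper interval coloring of a graph $G$ is an assignment of colors (natural numbers) to the edges of $G$, not necessarily proper, such that for every vertex $v$ the set of colors on the edges incident with $v$ is an integral interval (a set of consecutive integers). It is $k$-improper if at most $k$ edges with the same color all share a common endpoint, i.e. at each vertex each color appears on at most $k$ incident edges. The interval coloring impropriety $\mu_{\mathrm{int}}(G)$ is the smallest positive integer $k$ such that $G$ has a $k$-improper interval coloring. *)

theory Defs
  imports Complex_Main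
begin

text \<open>A finite simple graph is given by its vertex set \<open>V\<close> and its set \<open>E\<close> of undirected edges,
  each edge being a two-element set of vertices.\<close>

definition simple_graph :: "'a set \<Rightarrow> 'a set set \<Rightarrow> bool" where
  "simple_graph V E \<longleftrightarrow> finite V \<and> (\<forall>e\<in>E. e \<subseteq> V \<and> card e = 2)"

definition incident_edges :: "'a set set \<Rightarrow> 'a \<Rightarrow> 'a set set" where
  "incident_edges E v = {e \<in> E. v \<in> e}"

definition degree :: "'a set set \<Rightarrow> 'a \<Rightarrow> nat" where
  "degree E v = card (incident_edges E v)"

text \<open>Only meaningful for finite nonempty \<open>V\<close>.\<close>

definition max_degree :: "'a set \<Rightarrow> 'a set set \<Rightarrow> nat" where
  "max_degree V E = Max (degree E ` V)"

inductive two_tree :: "'a set \<Rightarrow> 'a set set \<Rightarrow> bool" where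
  triangle: "distinct [a, b, c] \<Longrightarrow> two_tree {a, b, c} {{a, b}, {b, c}, {a, c}}"
| extend: "two_tree V E \<Longrightarrow> {a, b} \<in> E \<Longrightarrow> v \<notin> V \<Longrightarrow>
    two_tree (insert v V) (E \<union> {{v, a}, {v, b}})"

text \<open>The empty set counts as an interval, so isolated vertices impose no condition on a coloring.\<close>

definition integral_interval :: "nat set \<Rightarrow> bool" where
  "integral_interval S \<longleftrightarrow> (\<exists>a b. S = {a..b})"

definition interval_coloring :: "'a set \<Rightarrow> 'a set set \<Rightarrow> ('a set \<Rightarrow> nat) \<Rightarrow> bool" where
  "interval_coloring V E c \<longleftrightarrow> (\<forall>v\<in>V. integral_interval (c ` incident_edges E v))"

definition improper_interval_coloring ::
    "nat \<Rightarrow> 'a set \<Rightarrow> 'a set set \<Rightarrow> ('a set \<Rightarrow> nat) \<Rightarrow> bool" where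
  "improper_interval_coloring k V E c \<longleftrightarrow>
     interval_coloring V E c \<and> (\<forall>v\<in>V. \<forall>i. card {e \<in> incident_edges E v. c e = i} \<le> k)"

definition mu_int :: "'a set \<Rightarrow> 'a set set \<Rightarrow> nat" where
  "mu_int V E = (LEAST k. 0 < k \<and> (\<exists>c. improper_interval_coloring k V E c))"

lemma two_tree_simple_graph:
  assumes "two_tree V E"
  shows "simple_graph V E"
  using assms
proof induction
  case (triangle a b c)
  then show ?case by (auto simp: simple_graph_def)
next
  case (extend V E a b v)
  then have "{a, b} \<subseteq> V" by (auto simp: simple_graph_def)
  with extend show ?case by (auto simp: simple_graph_def card_2_iff)
qed

lemma two_tree_nonempty: "two_tree V E \<Longrightarrow> V \<noteq> {}"
  by (induction rule: two_tree.induct) auto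

lemma simple_graph_finite_edges:
  assumes "simple_graph V E"
  shows "finite E"
proof -
  have "E \<subseteq> Pow V" "finite V" using assms by (auto simp: simple_graph_def)
  then show ?thesis using finite_subset finite_Pow_iff by metis
qed

text \<open>A constant coloring shows that the minimum in the definition of \<open>mu_int\<close> is attained.\<close>

lemma improper_interval_coloring_exists:
  assumes "simple_graph V E"
  shows "\<exists>k>0. \<exists>c. improper_interval_coloring k V E c"
proof -
  have fin: "finite E" using assms by (rule simple_graph_finite_edges)
  have "integral_interval ((\<lambda>_. 0) ` incident_edges E v)" for v
  proof (cases "incident_edges E v = {}")
    case True
    have "{} = {1..0::nat}" by simp
    then show ?thesis using True unfolding integral_interval_def by (metis image_empty)
  next
    case False
    then have "(\<lambda>_. 0) ` incident_edges E v = {0..0::nat}" by auto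
    then show ?thesis unfolding integral_interval_def by blast
  qed
  moreover have "card {e \<in> incident_edges E v. (0::nat) = i} \<le> Suc (card E)" for v i
    using card_mono[OF fin, of "{e \<in> incident_edges E v. (0::nat) = i}"]
    by (auto simp: incident_edges_def)
  ultimately have "improper_interval_coloring (Suc (card E)) V E (\<lambda>_. 0)"
    unfolding improper_interval_coloring_def interval_coloring_def by blast
  then show ?thesis by blast
qed

lemma mu_int_attained:
  assumes "simple_graph V E"
  shows "0 < mu_int V E" "\<exists>c. improper_interval_coloring (mu_int V E) V E c"
  using LeastI_ex[OF improper_interval_coloring_exists[OF assms]]
  unfolding mu_int_def by auto

end

theory Submission
  imports Defs "HOL-Combinatorics.Transposition"
begin

text \<open>Let \<open>K = \<lceil>\<Delta>/3\<rceil>\<close>. If \<open>\<Delta> = 3\<close>, the 2-tree is the diamond, which has a proper interval coloring.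
Otherwise \<open>K \<ge> 2\<close>, all degrees are at most \<open>3K\<close>, and the colors 1, 2, 3 suffice: color so that every
color occurs at most \<open>K\<close> times at every vertex and no vertex sees 1 and 3 without 2.

Number the vertices in the order in which the 2-tree is built, so that every vertex \<open>w\<close> after the
first two has exactly two earlier neighbors \<open>p w < q w\<close>, its parents, which are adjacent. Process the vertices
in this order; processing \<open>a\<close> colors at once all edges from \<open>a\<close> to later vertices. Such an edge
\<open>aw\<close> is unconstrained if \<open>a = p w\<close>. If \<open>a = q w\<close>, its color must differ by at most 1
from the color already given to the edge from \<open>p w\<close> to \<open>w\<close>, since a vertex of degree 2 must not see just 1
and 3. A previous color 2 is no restriction, 1 allows 1 and 2, and 3 allows 2 and 3. The capacities
\<open>K\<close> can therefore be met at \<open>a\<close> if and only if two counting conditions hold: for \<open>t = 1\<close> and for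
\<open>t = 3\<close>, the constrained edges with previous color \<open>t\<close> and the edges to parents of \<open>a\<close>
colored \<open>t\<close> or 2 number at most \<open>2K\<close> together.

The counting conditions almost hold by themselves. The constrained edges at \<open>a\<close> with previous color
\<open>t\<close> lead to vertices joined in color \<open>t\<close> to one of the two parents of \<open>a\<close>, so each parent
contributes at most \<open>K\<close>, and one less if its edge to \<open>a\<close> has color \<open>t\<close> as well. The
conditions can fail only if all \<open>K\<close> edges of color \<open>t\<close> at some parent \<open>x\<close> of \<open>a\<close> lead to
common neighbors of \<open>x\<close> and \<open>a\<close>, while the edge \<open>xa\<close> has another color. When \<open>x\<close> is
processed, this can be avoided by exchanging the color of \<open>xa\<close> with that of one of these \<open>K\<close> edges
(lemma \<open>exchange_with_child\<close>), with two exceptions: \<open>xa\<close> may be barred from color \<open>t\<close> because the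
edge to \<open>a\<close> from its other parent has color \<open>4 - t\<close>, or \<open>xa\<close> may have color \<open>4 - t\<close> and almost
\<open>2K\<close> vertices attached to it, and then the exchange could create the same defect for \<open>4 - t\<close>. In both
exceptions at most one of the two edges between \<open>a\<close> and its parents has color \<open>t\<close> or 2, and if one has,
the parent other than \<open>x\<close> contributes fewer than \<open>K\<close> edges, by the exchanges made there or by the degree
bound \<open>3K\<close>. So the counting condition still holds (lemma \<open>counting_conditions_hold\<close>).\<close>

section \<open>Coloring the edges from one vertex to later vertices\<close>

definition near :: "nat \<Rightarrow> nat \<Rightarrow> bool" where
  "near i j \<longleftrightarrow> i \<le> Suc j \<and> j \<le> Suc i"

lemma exists_three_coloring_with_capacities:
  assumes "finite Z" "card Z \<le> i + j + k"
  shows "\<exists>g. (\<forall>w\<in>Z. g w \<in> {1, 2, 3::nat}) \<and> card {w \<in> Z. g w = 1} \<le> i \<and>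
    card {w \<in> Z. g w = 2} \<le> j \<and> card {w \<in> Z. g w = 3} \<le> k"
  using assms
proof (induction arbitrary: i j k rule: finite_induct)
  case empty
  then show ?case by simp
next
  case (insert z Z)
  have *: "{w \<in> insert z Z. (g(z := q)) w = t} =
      (if t = q then insert z {w \<in> Z. g w = t} else {w \<in> Z. g w = t})"
    for g :: "'a \<Rightarrow> nat" and q t using insert.hyps by auto
  from insert.prems insert.hyps consider i' where "i = Suc i'" | j' where "j = Suc j'"
    | k' where "k = Suc k'"
    by (cases i; cases j; cases k) auto
  then show ?case
  proof cases
    case 1
    with insert.prems insert.hyps have "card Z \<le> i' + j + k" by simp
    from insert.IH[OF this] obtain g where g: "\<forall>w\<in>Z. g w \<in> {1, 2, 3::nat}"
      "card {w \<in> Z. g w = 1} \<le> i'" "card {w \<in> Z. g w = 2} \<le> j" "card {w \<in> Z. g w = 3} \<le> k"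
      by blast
    then show ?thesis using insert.hyps 1
      by (intro exI[of _ "g(z := 1)"]) (simp only: *, simp add: card_insert_if)
  next
    case 2
    with insert.prems insert.hyps have "card Z \<le> i + j' + k" by simp
    from insert.IH[OF this] obtain g where g: "\<forall>w\<in>Z. g w \<in> {1, 2, 3::nat}"
      "card {w \<in> Z. g w = 1} \<le> i" "card {w \<in> Z. g w = 2} \<le> j'" "card {w \<in> Z. g w = 3} \<le> k"
      by blast
    then show ?thesis using insert.hyps 2
      by (intro exI[of _ "g(z := 2)"]) (simp only: *, simp add: card_insert_if)
  next
    case 3
    with insert.prems insert.hyps have "card Z \<le> i + j + k'" by simp
    from insert.IH[OF this] obtain g where g: "\<forall>w\<in>Z. g w \<in> {1, 2, 3::nat}"
      "card {w \<in> Z. g w = 1} \<le> i" "card {w \<in> Z. g w = 2} \<le> j" "card {w \<in> Z. g w = 3} \<le> k'"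
      by blast
    then show ?thesis using insert.hyps 3
      by (intro exI[of _ "g(z := 3)"]) (simp only: *, simp add: card_insert_if)
  qed
qed

text \<open>The situation at a single vertex \<open>a\<close>. The set \<open>N\<close> consists of the later neighbors, \<open>r t\<close> counts the
edges to parents of \<open>a\<close> with color \<open>t\<close>, and the edge to \<open>w\<close> needs a color near \<open>s w\<close>;
the value \<open>s w = 2\<close> leaves \<open>w\<close> free. If \<open>w\<close> was attached to an edge from \<open>a\<close> to \<open>b \<in> N\<close>,
then \<open>par w = b\<close>; any value of \<open>par w\<close> outside \<open>N\<close> means that there is no such \<open>b\<close>. The
assumptions \<open>low\<close> and \<open>high\<close> are the two counting conditions.\<close>

locale vertex_completion =
  fixes K :: nat and N :: "'b set" and s :: "'b \<Rightarrow> nat" and par :: "'b \<Rightarrow> 'b"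
    and r :: "nat \<Rightarrow> nat"
  assumes K: "2 \<le> K"
    and fin: "finite N"
    and s_range: "w \<in> N \<Longrightarrow> s w \<in> {1, 2, 3}"
    and par_neq: "w \<in> N \<Longrightarrow> par w \<noteq> w"
    and par_free: "w \<in> N \<Longrightarrow> par w \<in> N \<Longrightarrow> s w = 2"
    and total: "card N + (r 1 + r 2 + r 3) \<le> 3 * K"
    and r_le: "r t \<le> K"
    and low: "card {w \<in> N. s w = 1} + (r 1 + r 2) \<le> 2 * K"
    and high: "card {w \<in> N. s w = 3} + (r 2 + r 3) \<le> 2 * K"
begin

definition children :: "'b \<Rightarrow> 'b set" where
  "children b = {w \<in> N. par w = b}"

definition valid :: "('b \<Rightarrow> nat) \<Rightarrow> bool" where
  "valid g \<longleftrightarrow> (\<forall>w\<in>N. g w \<in> {1, 2, 3} \<and> near (g w) (s w)) \<and>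
     (\<forall>t\<in>{1, 2, 3}. card {w \<in> N. g w = t} + r t \<le> K)"

text \<open>A pair \<open>(b, t)\<close> is bad if giving the edge to \<open>b\<close> color \<open>t\<close> would have been legal and all
\<open>K\<close> occurrences of \<open>t\<close> are at children of \<open>b\<close>, which could break the counting condition at
\<open>b\<close> later. If the edge to \<open>b\<close> has color 1 or 3, this is a danger only as long as \<open>b\<close> has at most
\<open>2K - 2\<close> children: more of them at one parent of \<open>b\<close> leave few for the other.\<close>

definition bad :: "('b \<Rightarrow> nat) \<Rightarrow> 'b \<Rightarrow> nat \<Rightarrow> bool" where
  "bad g b t \<longleftrightarrow> b \<in> N \<and> near t (s b) \<and> g b \<noteq> t \<and>
     (g b = 2 \<or> card (children b) \<le> 2 * K - 2) \<and> K \<le> card {w \<in> children b. g w = t}"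

text \<open>The counting conditions suffice by a greedy choice: the neighbors restricted to \<open>{1, 2}\<close> use up color 1 before
they turn to 2, those restricted to \<open>{2, 3}\<close> use up color 3 before they turn to 2, and the free neighbors
take what is left.\<close>

lemma valid_exists: "\<exists>g. valid g"
proof -
  define Z where "Z t = {w \<in> N. s w = t}" for t
  have finZ: "finite (Z t)" for t using fin by (simp add: Z_def)
  define i1 where "i1 = min (card (Z 1)) (K - r 1)"
  define i3 where "i3 = min (card (Z 3)) (K - r 3)"
  define m1 where "m1 = card (Z 1) - i1"
  define m3 where "m3 = card (Z 3) - i3"
  have N: "N = Z 1 \<union> Z 2 \<union> Z 3" using s_range by (auto simp: Z_def)
  have disj: "Z 1 \<inter> Z 2 = {}" "(Z 1 \<union> Z 2) \<inter> Z 3 = {}" by (auto simp: Z_def)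
  have cN: "card N = card (Z 1) + card (Z 2) + card (Z 3)"
    using N disj finZ by (simp add: card_Un_disjoint)
  have lo: "card (Z 1) + (r 1 + r 2) \<le> 2 * K" and hi: "card (Z 3) + (r 2 + r 3) \<le> 2 * K"
    using low high by (simp_all add: Z_def)
  have cap1: "card (Z 1) \<le> i1 + m1 + 0" and cap3: "card (Z 3) \<le> 0 + m3 + i3"
    by (auto simp: m1_def m3_def)
  obtain g1 where g1: "\<forall>w\<in>Z 1. g1 w \<in> {1, 2, 3::nat}" "card {w \<in> Z 1. g1 w = 1} \<le> i1"
      "card {w \<in> Z 1. g1 w = 2} \<le> m1" "card {w \<in> Z 1. g1 w = 3} \<le> 0"
    using exists_three_coloring_with_capacities[OF finZ, of 1 i1 m1 0] cap1 by blast
  obtain g3 where g3: "\<forall>w\<in>Z 3. g3 w \<in> {1, 2, 3::nat}" "card {w \<in> Z 3. g3 w = 1} \<le> 0"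
      "card {w \<in> Z 3. g3 w = 2} \<le> m3" "card {w \<in> Z 3. g3 w = 3} \<le> i3"
    using exists_three_coloring_with_capacities[OF finZ, of 3 0 m3 i3] cap3 by blast
  have caps: "i1 + r 1 \<le> K" "i3 + r 3 \<le> K" "m1 + m3 + r 2 \<le> K"
    using lo hi cN total r_le[of 1] r_le[of 2] r_le[of 3]
    unfolding i1_def i3_def m1_def m3_def min_def by (auto split: if_splits)
  have "card (Z 2) \<le> (K - r 1 - i1) + (K - r 2 - m1 - m3) + (K - r 3 - i3)"
  proof -
    have "i1 + m1 = card (Z 1)" "i3 + m3 = card (Z 3)"
      by (simp_all add: i1_def i3_def m1_def m3_def)
    moreover have "i1 + m1 + i3 + m3 + card (Z 2) + (r 1 + r 2 + r 3) \<le> 3 * K"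
      using calculation cN total by linarith
    moreover have "(K - r 1 - i1) + (K - r 2 - m1 - m3) + (K - r 3 - i3) +
        (i1 + m1 + i3 + m3 + (r 1 + r 2 + r 3)) = 3 * K"
      using caps by simp
    ultimately show ?thesis by linarith
  qed
  then obtain g2 where g2: "\<forall>w\<in>Z 2. g2 w \<in> {1, 2, 3::nat}"
      "card {w \<in> Z 2. g2 w = 1} \<le> K - r 1 - i1"
      "card {w \<in> Z 2. g2 w = 2} \<le> K - r 2 - m1 - m3" "card {w \<in> Z 2. g2 w = 3} \<le> K - r 3 - i3"
    using exists_three_coloring_with_capacities[OF finZ] by blast
  define g where "g w = (if s w = 1 then g1 w else if s w = 2 then g2 w else g3 w)" for w
  have "{w \<in> N. g w = t} = {w \<in> Z 1. g1 w = t} \<union> {w \<in> Z 2. g2 w = t} \<union> {w \<in> Z 3. g3 w = t}" for t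
    using N by (auto simp: g_def Z_def)
  moreover have "card ({w \<in> Z 1. g1 w = t} \<union> {w \<in> Z 2. g2 w = t} \<union> {w \<in> Z 3. g3 w = t}) \<le>
      card {w \<in> Z 1. g1 w = t} + card {w \<in> Z 2. g2 w = t} + card {w \<in> Z 3. g3 w = t}" for t
    by (meson add_le_mono1 card_Un_le le_trans)
  ultimately have cnt: "card {w \<in> N. g w = t} \<le>
      card {w \<in> Z 1. g1 w = t} + card {w \<in> Z 2. g2 w = t} + card {w \<in> Z 3. g3 w = t}" for t
    by simp
  have "card {w \<in> N. g w = t} + r t \<le> K" if "t \<in> {1, 2, 3}" for t
    using that cnt[of 1] cnt[of 2] cnt[of 3] g1 g2 g3 caps by auto
  moreover have "g w \<in> {1, 2, 3} \<and> near (g w) (s w)" if "w \<in> N" for w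
  proof -
    have "g1 w \<noteq> 3" if "w \<in> Z 1" using g1(4) that finZ[of 1] by auto
    moreover have "g3 w \<noteq> 1" if "w \<in> Z 3" using g3(2) that finZ[of 3] by auto
    ultimately show ?thesis using s_range[OF that] g1(1) g2(1) g3(1) that
      by (auto simp: g_def Z_def near_def)
  qed
  ultimately show ?thesis unfolding valid_def by blast
qed

text \<open>Color 2 is legal everywhere, so if it is absent, any edge can be recolored with it. The exchanges below preserve the set of
colors.\<close>

lemma valid_with_two_exists:
  assumes "N \<noteq> {}"
  shows "\<exists>g. valid g \<and> (r 2 = 0 \<longrightarrow> 2 \<in> g ` N)"
proof -
  obtain g where g: "valid g" using valid_exists by blast
  show ?thesis
  proof (cases "r 2 = 0 \<and> 2 \<notin> g ` N")
    case False
    then show ?thesis using g by blast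
  next
    case True
    obtain z where z: "z \<in> N" using assms by blast
    let ?g = "g(z := 2)"
    have "{w \<in> N. ?g w = 2} = {z}" using True z by auto
    then have two: "card {w \<in> N. ?g w = 2} + r 2 \<le> K" using True K by simp
    have other: "card {w \<in> N. ?g w = t} \<le> card {w \<in> N. g w = t}" if "t \<noteq> 2" for t
      using that fin by (intro card_mono) auto
    have near: "near 2 (s z)" using s_range[OF z] by (auto simp: near_def)
    have "card {w \<in> N. ?g w = t} + r t \<le> K" if t: "t \<in> {1, 2, 3}" for t
    proof (cases "t = 2")
      case False
      have "card {w \<in> N. g w = t} + r t \<le> K" using g t unfolding valid_def by blast
      then show ?thesis using other[OF False] by linarith
    qed (use two in simp)
    moreover have "?g w \<in> {1, 2, 3} \<and> near (?g w) (s w)" if "w \<in> N" for w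
      using that g near by (auto simp: valid_def)
    ultimately have "valid ?g" unfolding valid_def by blast
    moreover have "2 \<in> ?g ` N" using z by (auto simp: image_def)
    ultimately show ?thesis by blast
  qed
qed

text \<open>Since \<open>K\<close> is also the capacity, \<open>K\<close> occurrences of a color among the children of \<open>b\<close> are all its
occurrences.\<close>

lemma color_class_subset_children:
  assumes "valid g" "t \<in> {1, 2, 3}" "K \<le> card {w \<in> children b. g w = t}"
  shows "{w \<in> N. g w = t} \<subseteq> children b"
proof -
  have "{w \<in> children b. g w = t} \<subseteq> {w \<in> N. g w = t}" by (auto simp: children_def)
  moreover have "card {w \<in> N. g w = t} \<le> K" using assms by (fastforce simp: valid_def)
  ultimately have "{w \<in> children b. g w = t} = {w \<in> N. g w = t}"
    using assms(3) fin by (intro card_seteq) auto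
  then show ?thesis by blast
qed

lemma two_colors_card_children:
  assumes "t \<noteq> u"
  shows "card {w \<in> children b. g w = t} + card {w \<in> children b. g w = u} \<le> card (children b)"
proof -
  have "finite (children b)" using fin by (simp add: children_def)
  then have "card ({w \<in> children b. g w = t} \<union> {w \<in> children b. g w = u}) \<le> card (children b)"
    by (intro card_mono) auto
  moreover have "card ({w \<in> children b. g w = t} \<union> {w \<in> children b. g w = u}) =
      card {w \<in> children b. g w = t} + card {w \<in> children b. g w = u}"
    using \<open>finite (children b)\<close> assms by (intro card_Un_disjoint) auto
  ultimately show ?thesis by simp
qed

text \<open>If \<open>(b, t)\<close> is bad, exchange the colors of \<open>b\<close> and of a child \<open>w\<close> of \<open>b\<close> with color \<open>t\<close>.
This is legal because \<open>w\<close> is free, and it keeps the size of every color class. Afterwards \<open>b\<close> itself has color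
\<open>t\<close> and is not its own child, while another vertex of color \<open>t\<close> still is a child of \<open>b\<close>, so no pair
\<open>(y, t)\<close> is bad. What needs care is that the other color \<open>u = 4 - t\<close> acquires no new bad pair,
so that the two colors can be repaired one after the other.\<close>

lemma exchange_with_child:
  assumes g: "valid g" and t: "t \<in> {1, 3}"
  shows "\<exists>g'. valid g' \<and> g' ` N = g ` N \<and> (\<forall>b. \<not> bad g' b t) \<and>
    (\<forall>b. bad g' b (4 - t) \<longrightarrow> bad g b (4 - t))"
proof (cases "\<exists>b. bad g b t")
  case False
  then show ?thesis using g by blast
next
  case True
  then obtain b where b: "bad g b t" ..
  define u where "u = 4 - t"
  have tu: "t \<noteq> u" "u \<noteq> 2" "t \<noteq> 2" "t \<in> {1,2,3}" "u \<in> {1,2,3}" using t by (auto simp: u_def)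
  have bN: "b \<in> N" and gb: "g b \<noteq> t" and near: "near t (s b)"
    and gb2: "g b = 2 \<or> card (children b) \<le> 2 * K - 2"
    and many: "K \<le> card {w \<in> children b. g w = t}" using b by (auto simp: bad_def)
  have finc: "finite (children x)" for x using fin by (simp add: children_def)
  obtain w1 where w1: "w1 \<in> {w \<in> children b. g w = t}"
    using many K by (metis (no_types, lifting) card.empty equals0I le_zero_eq not_numeral_le_zero order_trans)
  have "card ({w \<in> children b. g w = t} - {w1}) \<noteq> 0" using many K w1 finc by simp
  then obtain w2 where w2: "w2 \<in> {w \<in> children b. g w = t}" "w2 \<noteq> w1"
    by (metis (no_types, lifting) Diff_iff card.empty equals0I insertCI)
  \<comment> \<open>The exchanged child may receive color 2, so it must not have all the edges of color \<open>u\<close> as children.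
    At most one vertex has, and there are at least two candidates, because \<open>K \<ge> 2\<close>.\<close>
  have "\<exists>w \<in> {w \<in> children b. g w = t}. card {x \<in> children w. g x = u} < K"
  proof (rule ccontr)
    assume "\<not> ?thesis"
    then have A: "K \<le> card {x \<in> children w1. g x = u}" "K \<le> card {x \<in> children w2. g x = u}"
      using w1 w2 by (auto simp: not_less)
    have "{w \<in> N. g w = u} \<subseteq> children w1" "{w \<in> N. g w = u} \<subseteq> children w2"
      using color_class_subset_children[OF g] tu A by blast+
    then have "{w \<in> N. g w = u} = {}" using w2 by (auto simp: children_def)
    then have none: "{x \<in> children w1. g x = u} = {}" by (auto simp: children_def)
    have "card {x \<in> children w1. g x = u} = 0" unfolding none by simp
    then show False using A(1) K by simp
  qed
  then obtain w where w: "w \<in> children b" "g w = t" and few: "card {x \<in> children w. g x = u} < K"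
    by blast
  have wN: "w \<in> N" "par w = b" "w \<noteq> b" using w gb by (auto simp: children_def)
  define g' where "g' = g \<circ> Transposition.transpose b w"
  have g'b: "g' b = t" and g'w: "g' w = g b" using w by (auto simp: g'_def)
  have g'x: "g' x = g x" if "x \<noteq> b" "x \<noteq> w" for x using that by (simp add: g'_def)
  have trN: "Transposition.transpose b w ` N = N" using bN wN by (simp add: transpose_image_eq)
  have cnt: "card {x \<in> N. g' x = v} = card {x \<in> N. g x = v}" for v
  proof -
    have "{x \<in> N. g' x = v} = Transposition.transpose b w ` {x \<in> N. g x = v}"
    proof (intro equalityI subsetI)
      fix x assume "x \<in> {x \<in> N. g' x = v}"
      then have "Transposition.transpose b w x \<in> {x \<in> N. g x = v}" using trN by (auto simp: g'_def)
      then show "x \<in> Transposition.transpose b w ` {x \<in> N. g x = v}"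
        by (metis image_eqI transpose_involutory)
    next
      fix x assume "x \<in> Transposition.transpose b w ` {x \<in> N. g x = v}"
      then show "x \<in> {x \<in> N. g' x = v}" using trN by (auto simp: g'_def)
    qed
    then show ?thesis by (metis (no_types, lifting) card_image inj_on_transpose)
  qed
  have s_w: "s w = 2" using par_free wN bN by blast
  have val': "valid g'"
  proof -
    have "g' x \<in> {1, 2, 3} \<and> near (g' x) (s x)" if "x \<in> N" for x
    proof -
      consider "x = b" | "x = w" | "x \<noteq> b" "x \<noteq> w" by blast
      then show ?thesis
      proof cases
        case 1 then show ?thesis using g'b near tu by simp
      next
        case 2
        have "g b \<in> {1, 2, 3}" using g bN unfolding valid_def by blast
        then show ?thesis using 2 g'w s_w by (auto simp: near_def)
      next
        case 3
        have "g x \<in> {1, 2, 3} \<and> near (g x) (s x)" using g that unfolding valid_def by blast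
        then show ?thesis by (simp only: g'x[OF 3])
      qed
    qed
    moreover have "\<forall>t\<in>{1, 2, 3}. card {w \<in> N. g' w = t} + r t \<le> K"
      using g unfolding valid_def cnt by blast
    ultimately show ?thesis unfolding valid_def by blast
  qed
  have img: "g' ` N = g ` N" unfolding g'_def image_comp[symmetric] trN ..
  have "\<not> bad g' y t" for y
  proof
    assume "bad g' y t"
    then have "{x \<in> N. g' x = t} \<subseteq> children y"
      using color_class_subset_children[OF val'] tu by (auto simp: bad_def)
    moreover obtain x where x: "x \<in> children b" "g x = t" "x \<noteq> w"
      using w1 w2 by (cases "w1 = w") auto
    moreover have "x \<in> N" "x \<noteq> b" "par x = b" using x gb by (auto simp: children_def)
    ultimately have "x \<in> children y" "b \<in> children y" using g'x g'b bN by auto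
    then show False using \<open>par x = b\<close> par_neq[OF bN] by (simp add: children_def)
  qed
  moreover have "bad g y u" if y: "bad g' y u" for y
  proof (cases "g b = 2")
    case True
    \<comment> \<open>The class of \<open>u\<close> is untouched, so only \<open>b\<close> and \<open>w\<close> could become bad. For \<open>b\<close>, this would
      take \<open>K\<close> children in each of the colors \<open>t\<close> and \<open>u\<close>, too many for a vertex not colored 2.\<close>
    have same: "g' x = u \<longleftrightarrow> g x = u" for x
      using True g'b g'w g'x[of x] w(2) tu by (cases "x = b"; cases "x = w") auto
    have many_u: "K \<le> card {x \<in> children y. g x = u}" using y by (simp add: bad_def same)
    have "y \<noteq> w" using many_u few by auto
    moreover have "y \<noteq> b"
    proof
      assume "y = b"
      then have "card (children b) \<le> 2 * K - 2" using y g'b tu by (auto simp: bad_def)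
      moreover have "K \<le> card {x \<in> children b. g x = u}" using many_u \<open>y = b\<close> by blast
      ultimately show False using two_colors_card_children[OF tu(1), of b g] many K by linarith
    qed
    ultimately have "g' y = g y" using g'x by blast
    then show ?thesis using y many_u unfolding bad_def by simp
  next
    case False
    then have gbu: "g b = u" and small: "card (children b) \<le> 2 * K - 2"
    proof -
      have "g b \<in> {1, 2, 3}" using g bN unfolding valid_def by blast
      then show "g b = u" using False gb t by (auto simp: u_def)
      show "card (children b) \<le> 2 * K - 2" using False gb2 by blast
    qed
    \<comment> \<open>Now \<open>w\<close> has color \<open>u\<close>, so only its parent \<open>b\<close> could be bad for \<open>u\<close>. But \<open>b\<close> would need \<open>K\<close>
      children of color \<open>t\<close> and \<open>K - 1\<close> of color \<open>u\<close> before the exchange, and it has at most \<open>2K - 2\<close>.\<close>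
    have "{x \<in> N. g' x = u} \<subseteq> children y"
      using color_class_subset_children[OF val'] tu y by (auto simp: bad_def)
    then have "w \<in> children y" using wN g'w gbu by auto
    then have yb: "y = b" using wN by (simp add: children_def)
    have "{x \<in> children b. g' x = u} \<subseteq> insert w {x \<in> children b. g x = u}"
    proof
      fix x assume "x \<in> {x \<in> children b. g' x = u}"
      then show "x \<in> insert w {x \<in> children b. g x = u}"
        using g'x[of x] g'b tu(1) by (cases "x = b"; cases "x = w") auto
    qed
    then have "card {x \<in> children b. g' x = u} \<le> card (insert w {x \<in> children b. g x = u})"
      by (intro card_mono) (auto simp: finc)
    also have "\<dots> \<le> Suc (card {x \<in> children b. g x = u})" by (rule card_insert_le_m1) auto
    finally have "K \<le> Suc (card {x \<in> children b. g x = u})" using y yb by (auto simp: bad_def)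
    then have False using two_colors_card_children[OF tu(1), of b g] many small K by linarith
    then show ?thesis ..
  qed
  ultimately show ?thesis using val' img unfolding u_def by blast
qed

lemma good_completion_exists:
  "\<exists>g. valid g \<and> (N \<noteq> {} \<longrightarrow> r 2 = 0 \<longrightarrow> 2 \<in> g ` N) \<and> (\<forall>b. \<forall>t\<in>{1, 3}. \<not> bad g b t)"
proof -
  obtain g0 where g0: "valid g0" "N \<noteq> {} \<longrightarrow> r 2 = 0 \<longrightarrow> 2 \<in> g0 ` N"
  proof (cases "N = {}")
    case True
    obtain g where "valid g" using valid_exists by blast
    then show thesis using True by (intro that) auto
  next
    case False
    from valid_with_two_exists[OF this] obtain g where "valid g" "r 2 = 0 \<longrightarrow> 2 \<in> g ` N" by metis
    then show thesis by (intro that) auto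
  qed
  have "\<exists>g'. valid g' \<and> g' ` N = g0 ` N \<and> (\<forall>b. \<not> bad g' b 1) \<and>
      (\<forall>b. bad g' b 3 \<longrightarrow> bad g0 b 3)"
    using exchange_with_child[OF g0(1), of 1] by (simp del: One_nat_def)
  then obtain g1 where g1: "valid g1" "g1 ` N = g0 ` N" "\<forall>b. \<not> bad g1 b 1" by metis
  have "\<exists>g'. valid g' \<and> g' ` N = g1 ` N \<and> (\<forall>b. \<not> bad g' b 3) \<and>
      (\<forall>b. bad g' b 1 \<longrightarrow> bad g1 b 1)"
    using exchange_with_child[OF g1(1), of 3] by simp
  then obtain g2 where g2: "valid g2" "g2 ` N = g1 ` N" "\<forall>b. \<not> bad g2 b 3" "\<forall>b. bad g2 b 1 \<longrightarrow> bad g1 b 1"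
    by metis
  have "\<forall>b. \<forall>t\<in>{1, 3}. \<not> bad g2 b t" using g1(3) g2(3,4) by simp
  moreover have "N \<noteq> {} \<longrightarrow> r 2 = 0 \<longrightarrow> 2 \<in> g2 ` N" using g2(2) g1(2) g0(2) by simp
  ultimately show ?thesis using g2(1) by metis
qed

end

section \<open>Processing the vertices in construction order\<close>

definition parents :: "(nat \<Rightarrow> nat) \<Rightarrow> (nat \<Rightarrow> nat) \<Rightarrow> nat \<Rightarrow> nat set" where
  "parents p q w = (if w = 0 then {} else {p w, q w})"

text \<open>Setting \<open>p 1 = q 1 = 0\<close> gives the second vertex a single parent, so that \<open>parents p q w\<close> is the set of
earlier neighbors for every \<open>w\<close>, and the membership condition says that the two parents are adjacent even for
\<open>q w = 1\<close>.\<close>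

definition construction_order :: "nat \<Rightarrow> (nat \<Rightarrow> nat) \<Rightarrow> (nat \<Rightarrow> nat) \<Rightarrow> bool" where
  "construction_order n p q \<longleftrightarrow> p 1 = 0 \<and> q 1 = 0 \<and>
     (\<forall>w. 2 \<le> w \<and> w < n \<longrightarrow> p w < q w \<and> q w < w \<and> p w \<in> parents p q (q w))"

lemma construction_order_parent_less:
  assumes "construction_order n p q" "u \<in> parents p q w" "w < n"
  shows "u < w"
  using assms by (cases "w = 1") (auto simp: construction_order_def parents_def split: if_splits)

locale ordered_two_tree =
  fixes n K :: nat and p q :: "nat \<Rightarrow> nat"
  assumes order: "construction_order n p q"
    and K: "2 \<le> K"
    and degree_le: "a < n \<Longrightarrow> card (parents p q a) + card {w. w < n \<and> a \<in> parents p q w} \<le> 3 * K"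
begin

definition later :: "nat \<Rightarrow> nat set" where
  "later a = {w. w < n \<and> a \<in> parents p q w}"

text \<open>The vertices that were attached to the edge \<open>ab\<close>, where \<open>a < b\<close>.\<close>

definition shared :: "nat \<Rightarrow> nat \<Rightarrow> nat set" where
  "shared a b = {w \<in> later a. p w = a \<and> q w = b}"

text \<open>The color that the color of the edge from \<open>a\<close> to \<open>w\<close> must be near to. The value 2 is near to all
three colors and stands for an edge \<open>aw\<close> without restriction.\<close>

definition prior :: "(nat \<Rightarrow> nat \<Rightarrow> nat) \<Rightarrow> nat \<Rightarrow> nat \<Rightarrow> nat" where
  "prior c a w = (if p w < a then c (p w) w else 2)"

text \<open>Here \<open>c u w\<close> is the color of the edge between \<open>u\<close> and \<open>w\<close> for \<open>u < w\<close>. The last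
clause excludes bad pairs; it is what the two parents of a vertex \<open>b\<close> guarantee for the moment when \<open>b\<close> is
processed.\<close>

definition completed :: "(nat \<Rightarrow> nat \<Rightarrow> nat) \<Rightarrow> nat \<Rightarrow> bool" where
  "completed c a \<longleftrightarrow>
     (\<forall>w\<in>later a. c a w \<in> {1, 2, 3} \<and> near (c a w) (prior c a w)) \<and>
     (\<forall>t\<in>{1, 2, 3}. card {w \<in> later a. c a w = t} + card {u \<in> parents p q a. c u a = t} \<le> K) \<and>
     (later a \<noteq> {} \<longrightarrow> 2 \<in> c a ` later a \<union> (\<lambda>u. c u a) ` parents p q a) \<and>
     (\<forall>b\<in>later a. \<forall>t\<in>{1, 3}. near t (prior c a b) \<and> c a b \<noteq> t \<and>
        (c a b = 2 \<or> card (shared a b) \<le> 2 * K - 2) \<longrightarrow> card {w \<in> shared a b. c a w = t} < K)"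

lemma parent_less: "u \<in> parents p q w \<Longrightarrow> w < n \<Longrightarrow> u < w"
  by (rule construction_order_parent_less[OF order])

lemma q_less: "1 \<le> w \<Longrightarrow> w < n \<Longrightarrow> q w < w"
  by (rule parent_less) (simp_all add: parents_def)

lemma p_less_q: "2 \<le> w \<Longrightarrow> w < n \<Longrightarrow> p w < q w"
  and p_parent_q: "2 \<le> w \<Longrightarrow> w < n \<Longrightarrow> p w \<in> parents p q (q w)"
  using order by (auto simp: construction_order_def)

lemma finite_parents: "finite (parents p q a)" and finite_later: "finite (later a)"
  by (auto simp: parents_def later_def)

lemma finite_shared: "finite (shared a b)"
  using finite_later by (simp add: shared_def)

lemma later_greater: "w \<in> later a \<Longrightarrow> a < w"
  using parent_less by (auto simp: later_def)

lemma later_iff: "w \<in> later a \<longleftrightarrow> w < n \<and> w \<noteq> 0 \<and> (p w = a \<or> q w = a)"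
  by (auto simp: later_def parents_def)

lemma second_later:
  assumes "w \<in> later a" "p w < a"
  shows "q w = a" "2 \<le> w" "p w \<in> parents p q a" "w \<in> shared (p w) a"
proof -
  show qw: "q w = a" using assms by (auto simp: later_iff)
  have w: "w < n" "w \<noteq> 0" using assms by (auto simp: later_iff)
  have "w \<noteq> 1" using assms qw order by (auto simp: construction_order_def)
  then show "2 \<le> w" using w by simp
  then show "p w \<in> parents p q a" using p_parent_q w qw by blast
  show "w \<in> shared (p w) a" using w qw by (auto simp: shared_def later_iff)
qed

text \<open>Processing a vertex changes nothing that the condition at an earlier vertex speaks about.\<close>

lemma completed_cong:
  assumes "\<And>u. u \<le> a \<Longrightarrow> c u = c' u" "a < n"
  shows "completed c a \<longleftrightarrow> completed c' a"
proof -
  have "c a = c' a" using assms by simp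
  moreover have "prior c a = prior c' a" using assms(1) by (auto simp: prior_def fun_eq_iff)
  moreover have "{u \<in> parents p q a. c u a = t} = {u \<in> parents p q a. c' u a = t}" for t
    using assms(1) parent_less[OF _ assms(2)] by (metis less_imp_le_nat)
  moreover have "(\<lambda>u. c u a) ` parents p q a = (\<lambda>u. c' u a) ` parents p q a"
    using assms(1) parent_less[OF _ assms(2)] by (intro image_cong) (auto simp: less_imp_le_nat)
  ultimately show ?thesis unfolding completed_def by simp
qed

text \<open>All these edges belong to the class of \<open>t\<close> at \<open>a\<close>, and so does the edge \<open>ab\<close> if it has color \<open>t\<close>.\<close>

lemma card_shared_first_le:
  assumes "completed c a" "b \<in> later a" "t \<in> {1, 2, 3}"
  shows "card {w \<in> shared a b. c a w = t} + (if c a b = t then 1 else 0) \<le> K"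
proof -
  have b: "b \<notin> shared a b" using later_greater assms(2) q_less by (auto simp: shared_def later_iff)
  let ?S = "{w \<in> shared a b. c a w = t} \<union> (if c a b = t then {b} else {})"
  have "card ?S = card {w \<in> shared a b. c a w = t} + (if c a b = t then 1 else 0)"
    using b finite_shared by auto
  moreover have "card ?S \<le> card {w \<in> later a. c a w = t}"
    using assms(2) finite_later by (intro card_mono) (auto simp: shared_def)
  moreover have "card {w \<in> later a. c a w = t} \<le> K"
  proof -
    have "card {w \<in> later a. c a w = t} + card {u \<in> parents p q a. c u a = t} \<le> K"
      using assms(1,3) unfolding completed_def by blast
    then show ?thesis by linarith
  qed
  ultimately show ?thesis by linarith
qed

text \<open>If the edge \<open>aw\<close> is restricted, then \<open>w\<close> was attached to the edge between \<open>a\<close> and one of its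
parents, because the two parents of \<open>w\<close> are adjacent.\<close>

lemma card_prior_le_sum_shared:
  "card {w \<in> later a. prior c a w = t} \<le> (\<Sum>u\<in>parents p q a. card {w \<in> shared u a. c u w = t})"
  if "t \<noteq> 2"
proof -
  have "{w \<in> later a. prior c a w = t} \<subseteq> (\<Union>u\<in>parents p q a. {w \<in> shared u a. c u w = t})"
  proof
    fix w assume w: "w \<in> {w \<in> later a. prior c a w = t}"
    then have "p w < a" using that by (auto simp: prior_def split: if_splits)
    with w second_later[of w a] show "w \<in> (\<Union>u\<in>parents p q a. {w \<in> shared u a. c u w = t})"
      by (auto simp: prior_def)
  qed
  then have "card {w \<in> later a. prior c a w = t} \<le> card (\<Union>u\<in>parents p q a. {w \<in> shared u a. c u w = t})"
    using finite_parents finite_shared by (intro card_mono) auto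
  also have "\<dots> \<le> (\<Sum>u\<in>parents p q a. card {w \<in> shared u a. c u w = t})"
    using finite_parents by (intro card_UN_le)
  finally show ?thesis .
qed

lemma parent_color:
  assumes "\<And>u. u < a \<Longrightarrow> completed c u" "a < n" "u \<in> parents p q a"
  shows "c u a \<in> {1, 2, 3}"
proof -
  have "a \<in> later u" using assms by (simp add: later_def)
  moreover have "completed c u" using assms parent_less by blast
  ultimately show ?thesis unfolding completed_def by blast
qed

lemma parents_near:
  assumes "\<And>u. u < a \<Longrightarrow> completed c u" "a < n" "2 \<le> a"
  shows "near (c (q a) a) (c (p a) a)"
proof -
  have "a \<in> later (q a)" using assms by (simp add: later_iff)
  moreover have "completed c (q a)" using assms q_less[of a] by simp
  ultimately have "near (c (q a) a) (prior c (q a) a)" unfolding completed_def by blast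
  then show ?thesis using p_less_q assms by (simp add: prior_def)
qed

text \<open>Let \<open>x < y\<close> be the parents of \<open>a\<close>, and let \<open>A t\<close> and \<open>D t\<close> count the vertices attached
to \<open>xa\<close> and \<open>ya\<close> whose edge to \<open>x\<close> and \<open>y\<close>, respectively, has color \<open>t\<close>. Both
numbers are at most \<open>K\<close>, and less for a parent whose edge to \<open>a\<close> has color \<open>t\<close>. This settles
every case in which no edge from \<open>a\<close> to a parent has color 2. An edge \<open>xa\<close> or \<open>ya\<close> of color 2 takes one more place,
and the absence of bad pairs at \<open>x\<close> and \<open>y\<close> makes up for it.\<close>

lemma counting_conditions_hold:
  assumes prev: "\<And>u. u < a \<Longrightarrow> completed c u" and a: "a < n" and t: "t \<in> {1, 3}"
  shows "card {w \<in> later a. prior c a w = t} + (card {u \<in> parents p q a. c u a = t} +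
    card {u \<in> parents p q a. c u a = 2}) \<le> 2 * K"
proof -
  have t2: "t \<noteq> 2" and t3: "t \<in> {1, 2, 3}" using t by auto
  consider "a = 0" | "a = 1" | "2 \<le> a" by linarith
  then show ?thesis
  proof cases
    case 1
    then have "parents p q a = {}" by (simp add: parents_def)
    then show ?thesis using card_prior_le_sum_shared[OF t2, of a c] by simp
  next
    case 2
    then have B: "parents p q a = {0}" using order by (simp add: parents_def construction_order_def)
    have "a \<in> later 0" using B a by (simp add: later_def)
    then have "card {w \<in> shared 0 a. c 0 w = t} + (if c 0 a = t then 1 else 0) \<le> K"
      using card_shared_first_le[OF prev _ t3, of 0 a] 2 by simp
    moreover have "card {w \<in> later a. prior c a w = t} \<le> card {w \<in> shared 0 a. c 0 w = t}"
      using card_prior_le_sum_shared[OF t2, of a c] by (simp add: B)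
    moreover have "card {u \<in> parents p q a. c u a = t} + card {u \<in> parents p q a. c u a = 2} \<le> 1"
    proof -
      have "{u \<in> parents p q a. c u a = v} = (if c 0 a = v then {0} else {})" for v using B by auto
      then show ?thesis using t2 by simp
    qed
    ultimately show ?thesis using K by linarith
  next
    case 3
    define x where "x = p a"
    define y where "y = q a"
    have xy: "x < y" "y < a" using p_less_q q_less 3 a by (auto simp: x_def y_def)
    have B: "parents p q a = {x, y}" using 3 by (simp add: parents_def x_def y_def)
    have fx: "a \<in> later x" and fy: "a \<in> later y" using B a by (auto simp: later_def)
    have cx: "completed c x" and cy: "completed c y" using prev xy by auto
    have px: "prior c x a = 2" and py: "prior c y a = c x a"
      using xy by (auto simp: prior_def x_def)
    define A where "A v = card {w \<in> shared x a. c x w = v}" for v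
    define D where "D v = card {w \<in> shared y a. c y w = v}" for v
    have count: "A t + (if c x a = t then 1 else 0) \<le> K" "D t + (if c y a = t then 1 else 0) \<le> K"
      using card_shared_first_le[OF cx fx t3] card_shared_first_le[OF cy fy t3]
      by (simp_all only: A_def D_def)
    have firstA: "A t < K" if "c x a \<noteq> t" "c x a = 2 \<or> card (shared x a) \<le> 2 * K - 2"
    proof -
      have "near t (prior c x a)" using t by (auto simp: px near_def)
      then show ?thesis using cx fx t that unfolding completed_def A_def by blast
    qed
    have firstD: "D t < K" if "near t (c x a)" "c y a \<noteq> t" "c y a = 2"
    proof -
      have "near t (prior c y a)" using that by (simp only: py)
      then show ?thesis using cy fy t that unfolding completed_def D_def by blast
    qed
    have colors: "c x a \<in> {1, 2, 3}" "c y a \<in> {1, 2, 3}"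
      using parent_color[OF prev a] B by auto
    have near: "near (c y a) (c x a)" using parents_near[OF prev a 3] by (simp add: x_def y_def)
    have size: "card (shared x a) + card (shared y a) + 2 \<le> 3 * K"
    proof -
      have "card (shared x a \<union> shared y a) = card (shared x a) + card (shared y a)"
        using xy finite_shared by (intro card_Un_disjoint) (auto simp: shared_def)
      moreover have "shared x a \<union> shared y a \<subseteq> {w. w < n \<and> a \<in> parents p q w}"
        by (auto simp: shared_def later_iff parents_def)
      then have "card (shared x a \<union> shared y a) \<le> card {w. w < n \<and> a \<in> parents p q w}"
        by (intro card_mono) auto
      moreover have "card (parents p q a) = 2" using B xy by simp
      ultimately show ?thesis using degree_le[OF a] by linarith
    qed
    have Dle: "D t \<le> card (shared y a)"
      unfolding D_def using finite_shared by (auto intro: card_mono)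
    \<comment> \<open>The case of \<open>xa\<close> colored \<open>4 - t\<close> and \<open>ya\<close> colored 2. If the pair at \<open>x\<close> is exempt because of its
      \<open>2K - 1\<close> or more attached vertices, at most \<open>K - 1\<close> are attached to \<open>ya\<close>.\<close>
    have large: "A t < K \<or> D t < K" if "c x a \<noteq> t"
      using firstA[OF that] size Dle K by linarith
    have second: "card {w \<in> later a. prior c a w = t} \<le> A t + D t"
      using card_prior_le_sum_shared[OF t2, of a c] xy by (simp add: A_def D_def B)
    have used: "card {u \<in> parents p q a. c u a = v} =
        (if c x a = v then 1 else 0) + (if c y a = v then 1 else 0)" for v
    proof -
      have "{u \<in> parents p q a. c u a = v} =
          (if c x a = v then {x} else {}) \<union> (if c y a = v then {y} else {})"
        using B by auto
      then show ?thesis using xy by auto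
    qed
    show ?thesis
      using second count firstA firstD large colors near t K unfolding used near_def
      by (elim insertE emptyE; simp; linarith)
  qed
qed

text \<open>The counting conditions at \<open>a\<close> are exactly what the one-vertex completion requires. Only the later neighbors
with first parent \<open>a\<close> can be children: the others were attached to an edge between \<open>a\<close> and an
earlier vertex, and the value \<open>a\<close>, which is not a later neighbor of itself, marks this for them.\<close>

lemma complete_next:
  assumes prev: "\<And>u. u < a \<Longrightarrow> completed c u" and a: "a < n"
  shows "\<exists>g. completed (c(a := g)) a"
proof -
  define par where "par w = (if p w = a then q w else a)" for w
  define r where "r t = (if t \<in> {1, 2, 3} then card {u \<in> parents p q a. c u a = t} else 0)" for t
  have a_notin: "a \<notin> later a" using later_greater by blast
  interpret vertex_completion K "later a" "prior c a" par r
  proof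
    show "2 \<le> K" by (rule K)
    show "finite (later a)" by (rule finite_later)
    show "prior c a w \<in> {1, 2, 3}" if w: "w \<in> later a" for w
    proof (cases "p w < a")
      case True
      then have "completed c (p w)" "w \<in> later (p w)" using prev w by (auto simp: later_iff)
      then show ?thesis using True unfolding completed_def prior_def by auto
    qed (simp add: prior_def)
    show "par w \<noteq> w" if "w \<in> later a" for w
      using that q_less[of w] a_notin by (auto simp: par_def later_iff)
    show "prior c a w = 2" if "w \<in> later a" "par w \<in> later a" for w
      using that a_notin by (auto simp: par_def prior_def split: if_splits)
    have col: "c u a \<in> {1, 2, 3}" if "u \<in> parents p q a" for u using parent_color[OF prev a that] .
    show "card (later a) + (r 1 + r 2 + r 3) \<le> 3 * K"
    proof -
      have "parents p q a = {u \<in> parents p q a. c u a = 1} \<union> {u \<in> parents p q a. c u a = 2} \<union>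
          {u \<in> parents p q a. c u a = 3}" using col by blast
      then have "card (parents p q a) = card ({u \<in> parents p q a. c u a = 1} \<union>
          {u \<in> parents p q a. c u a = 2} \<union> {u \<in> parents p q a. c u a = 3})" by simp
      also have "\<dots> = r 1 + r 2 + r 3"
        unfolding r_def using finite_parents by (subst card_Un_disjoint; auto)+
      finally show ?thesis using degree_le[OF a] by (simp add: later_def)
    qed
    show "r t \<le> K" for t
    proof -
      have "card {u \<in> parents p q a. c u a = t} \<le> card (parents p q a)"
        using finite_parents by (intro card_mono) auto
      also have "\<dots> \<le> 2" by (simp add: parents_def card_insert_if)
      finally show ?thesis using K by (simp add: r_def)
    qed
    show "card {w \<in> later a. prior c a w = 1} + (r 1 + r 2) \<le> 2 * K"
      using counting_conditions_hold[OF prev a, of 1] by (simp add: r_def)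
    show "card {w \<in> later a. prior c a w = 3} + (r 2 + r 3) \<le> 2 * K"
      using counting_conditions_hold[OF prev a, of 3] by (simp add: r_def add.commute)
  qed
  obtain g where g: "valid g" "later a \<noteq> {} \<longrightarrow> r 2 = 0 \<longrightarrow> 2 \<in> g ` later a"
    "\<forall>b. \<forall>t\<in>{1, 3}. \<not> bad g b t" using good_completion_exists by metis
  let ?c = "c(a := g)"
  have prior: "prior ?c a = prior c a" by (auto simp: prior_def)
  have parents: "?c u a = c u a" if "u \<in> parents p q a" for u using parent_less[OF that a] by simp
  have shared: "children b = shared a b" if "b \<in> later a" for b
    using that a_notin by (auto simp: children_def shared_def par_def)
  have capacity: "card {w \<in> later a. ?c a w = t} + card {u \<in> parents p q a. ?c u a = t} \<le> K"
    if "t \<in> {1, 2, 3}" for t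
  proof -
    have "{u \<in> parents p q a. ?c u a = t} = {u \<in> parents p q a. c u a = t}"
      using parents by (intro Collect_cong) metis
    then have "card {u \<in> parents p q a. ?c u a = t} = r t" using that unfolding r_def by presburger
    moreover have "card {w \<in> later a. g w = t} + r t \<le> K" using g(1) that unfolding valid_def by blast
    ultimately show ?thesis by simp
  qed
  have two: "2 \<in> ?c a ` later a \<union> (\<lambda>u. ?c u a) ` parents p q a" if "later a \<noteq> {}"
  proof (cases "r 2 = 0")
    case True
    then show ?thesis using g(2) that by auto
  next
    case False
    have "{u \<in> parents p q a. c u a = 2} \<noteq> {}"
    proof
      assume none: "{u \<in> parents p q a. c u a = 2} = {}"
      show False using False unfolding r_def none by simp
    qed
    then obtain u where "u \<in> parents p q a" "c u a = 2" by blast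
    then show ?thesis using parents by (metis UnCI image_eqI)
  qed
  have spread: "card {w \<in> shared a b. ?c a w = t} < K"
    if "b \<in> later a" "t \<in> {1, 3}" "near t (prior c a b) \<and> ?c a b \<noteq> t \<and>
        (?c a b = 2 \<or> card (shared a b) \<le> 2 * K - 2)" for b t
  proof -
    have "\<not> bad g b t" using g(3) that(2) by blast
    then show ?thesis using that shared[OF that(1)] unfolding bad_def by auto
  qed
  have lists: "?c a w \<in> {1, 2, 3} \<and> near (?c a w) (prior c a w)" if "w \<in> later a" for w
    using g(1) that unfolding valid_def by simp
  have "completed ?c a"
    unfolding completed_def prior by (intro conjI ballI impI; (rule capacity two lists[THEN conjunct1] lists[THEN conjunct2] spread)?; assumption)
  then show ?thesis by (rule exI[of _ g])
qed

lemma all_completed: "\<exists>c. \<forall>a<n. completed c a"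
proof -
  have "\<exists>c. \<forall>a<m. completed c a" if "m \<le> n" for m
    using that
  proof (induction m)
    case (Suc m)
    then obtain c where c: "\<forall>a<m. completed c a" by auto
    obtain g where g: "completed (c(m := g)) m" using complete_next[of m c] c Suc.prems by auto
    have "completed (c(m := g)) a" if "a < m" for a
      using c that Suc.prems completed_cong[of a c "c(m := g)"] by auto
    then have "\<forall>a<Suc m. completed (c(m := g)) a" using g by (metis less_antisym)
    then show ?case by blast
  qed simp
  then show ?thesis by blast
qed

end

section \<open>From construction orders back to graphs\<close>

lemma integral_interval_small:
  assumes "S \<subseteq> {1, 2, 3}" "1 \<in> S \<Longrightarrow> 3 \<in> S \<Longrightarrow> 2 \<in> S"
  shows "integral_interval S"
proof -
  have "S \<in> {{}, {1}, {2}, {3}, {1, 2}, {2, 3}, {1, 2, 3}}"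
    using assms by (cases "1 \<in> S"; cases "2 \<in> S"; cases "3 \<in> S") auto
  moreover have "{} = {1..0::nat}" "{1} = {1..1::nat}" "{2} = {2..2::nat}" "{3} = {3..3::nat}"
    "{1, 2} = {1..2::nat}" "{2, 3} = {2..3::nat}" "{1, 2, 3} = {1..3::nat}" by auto
  ultimately show ?thesis unfolding integral_interval_def by (elim insertE emptyE) metis+
qed

definition ordered_edges :: "nat \<Rightarrow> (nat \<Rightarrow> nat) \<Rightarrow> (nat \<Rightarrow> nat) \<Rightarrow> (nat \<Rightarrow> 'a) \<Rightarrow> 'a set set" where
  "ordered_edges n p q h = {{h u, h w} | u w. w < n \<and> u \<in> parents p q w}"

lemma two_tree_construction_order:
  assumes "two_tree V E"
  shows "\<exists>n p q h. construction_order n p q \<and> inj_on h {..<n} \<and> V = h ` {..<n} \<and>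
    E = ordered_edges n p q h"
  using assms
proof induction
  case (triangle a b c)
  define h where "h i = (if i = 0 then a else if i = 1 then b else c)" for i :: nat
  define q where "q w = w - 1" for w :: nat
  define p :: "nat \<Rightarrow> nat" where "p w = 0" for w
  have lt: "{..<3::nat} = {0, 1, 2}" by auto
  have "construction_order 3 p q"
    by (auto simp: construction_order_def parents_def p_def q_def)
  moreover have "inj_on h {..<3}" "{a, b, c} = h ` {..<3}"
    using triangle unfolding lt by (auto simp: h_def)
  moreover have "ordered_edges 3 p q h = {{a, b}, {b, c}, {a, c}}"
  proof -
    have "ordered_edges 3 p q h = (\<Union>w\<in>{..<3}. (\<lambda>u. {h u, h w}) ` parents p q w)"
      by (auto simp: ordered_edges_def)
    also have "\<dots> = {{a, b}, {b, c}, {a, c}}"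
      unfolding lt by (auto simp: parents_def p_def q_def h_def)
    finally show ?thesis .
  qed
  ultimately show ?case by metis
next
  case (extend V E a b v)
  then obtain n p q h where 1: "construction_order n p q" "inj_on h {..<n}" "V = h ` {..<n}"
    "E = ordered_edges n p q h" by metis
  obtain i j where ij: "j < n" "i \<in> parents p q j" "{a, b} = {h i, h j}"
    using extend.hyps(2) 1(4) unfolding ordered_edges_def by blast
  have j0: "j \<noteq> 0" using ij(2) by (cases "j = 0") (simp_all add: parents_def)
  have less: "u < w" if "u \<in> parents p q w" "w < n" for u w
    using construction_order_parent_less[OF 1(1)] that .
  have "i < j" using less ij by blast
  let ?p = "p(n := i)" and ?q = "q(n := j)" and ?h = "h(n := v)"
  have par: "parents ?p ?q w = parents p q w" if "w < n" for w using that by (simp add: parents_def)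
  have parn: "parents ?p ?q n = {i, j}" using ij by (simp add: parents_def)
  have "construction_order (Suc n) ?p ?q"
  proof -
    have "n \<noteq> 1" using ij j0 by simp
    moreover have "?p w < ?q w \<and> ?q w < w \<and> ?p w \<in> parents ?p ?q (?q w)" if "2 \<le> w" "w < Suc n" for w
    proof (cases "w = n")
      case True
      then show ?thesis using ij \<open>i < j\<close> par[of j] by simp
    next
      case False
      then have "w < n" using that by simp
      then have "p w < q w \<and> q w < w \<and> p w \<in> parents p q (q w)"
        using 1(1) that by (simp add: construction_order_def)
      then show ?thesis using False par[of "q w"] \<open>w < n\<close> by simp
    qed
    ultimately show ?thesis using 1(1) unfolding construction_order_def by simp
  qed
  moreover have "inj_on ?h {..<Suc n}" "insert v V = ?h ` {..<Suc n}"
    using 1(2,3) extend.hyps(3) by (auto simp: inj_on_def lessThan_Suc)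
  moreover have "E \<union> {{v, a}, {v, b}} = ordered_edges (Suc n) ?p ?q ?h"
  proof -
    have *: "ordered_edges m p q h = (\<Union>w\<in>{..<m}. (\<lambda>u. {h u, h w}) ` parents p q w)"
      for m p q and h :: "nat \<Rightarrow> 'a" by (auto simp: ordered_edges_def)
    have old: "(\<lambda>u. {?h u, ?h w}) ` parents ?p ?q w = (\<lambda>u. {h u, h w}) ` parents p q w" if "w < n" for w
      unfolding par[OF that] using that by (intro image_cong) (auto dest: less[OF _ that])
    have new: "(\<lambda>u. {?h u, ?h n}) ` parents ?p ?q n = {{v, a}, {v, b}}"
    proof -
      have "(\<lambda>u. {?h u, ?h n}) ` parents ?p ?q n = {{v, h i}, {v, h j}}"
        unfolding parn using ij \<open>i < j\<close> by (auto simp: insert_commute)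
      also have "\<dots> = (\<lambda>x. {v, x}) ` {h i, h j}" by simp
      also have "\<dots> = {{v, a}, {v, b}}" unfolding ij(3)[symmetric] by simp
      finally show ?thesis .
    qed
    show ?thesis unfolding 1(4) * lessThan_Suc using old new by (simp add: Un_commute)
  qed
  ultimately show ?case by metis
qed

text \<open>Each edge at \<open>h a\<close> is determined by its other end, so that counting edges at a vertex becomes
counting earlier and later neighbors.\<close>

lemma incident_edges_ordered_edges:
  assumes order: "construction_order n p q" and h: "inj_on h {..<n}" and a: "a < n"
  defines "W \<equiv> {w. w < n \<and> a \<in> parents p q w}"
  shows "incident_edges (ordered_edges n p q h) (h a) = (\<lambda>u. {h a, h u}) ` (parents p q a \<union> W)"
    and "inj_on (\<lambda>u. {h a, h u}) (parents p q a \<union> W)"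
    and "parents p q a \<inter> W = {}"
proof -
  note less = construction_order_parent_less[OF order]
  have nbr: "u < n \<and> u \<noteq> a" if "u \<in> parents p q a \<union> W" for u
    using that a less[of u a] less[of a u] by (auto simp: W_def)
  show "incident_edges (ordered_edges n p q h) (h a) = (\<lambda>u. {h a, h u}) ` (parents p q a \<union> W)"
  proof (intro equalityI subsetI)
    fix e assume "e \<in> incident_edges (ordered_edges n p q h) (h a)"
    then obtain u w where uw: "e = {h u, h w}" "w < n" "u \<in> parents p q w" "h a \<in> {h u, h w}"
      by (auto simp: incident_edges_def ordered_edges_def)
    have "u < w" using less uw(2,3) by blast
    then have "a = u \<or> a = w" using uw h a by (auto simp: inj_on_def)
    then show "e \<in> (\<lambda>u. {h a, h u}) ` (parents p q a \<union> W)"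
      using uw by (auto simp: W_def insert_commute)
  next
    fix e assume "e \<in> (\<lambda>u. {h a, h u}) ` (parents p q a \<union> W)"
    then obtain u where u: "e = {h a, h u}" "u \<in> parents p q a \<or> u \<in> W" by blast
    have "e = {h u, h a}" using u(1) by (simp add: insert_commute)
    then have "e \<in> ordered_edges n p q h"
      using u a unfolding ordered_edges_def W_def by blast
    then show "e \<in> incident_edges (ordered_edges n p q h) (h a)"
      using u(1) by (simp add: incident_edges_def)
  qed
  show "inj_on (\<lambda>u. {h a, h u}) (parents p q a \<union> W)"
  proof (rule inj_onI)
    fix u w assume uw: "u \<in> parents p q a \<union> W" "w \<in> parents p q a \<union> W"
      and "{h a, h u} = {h a, h w}"
    then have "h u = h w" by (auto simp: doubleton_eq_iff)
    then show "u = w" using nbr[OF uw(1)] nbr[OF uw(2)] h by (auto simp: inj_on_def)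
  qed
  show "parents p q a \<inter> W = {}"
  proof (rule ccontr)
    assume "\<not> ?thesis"
    then obtain u where "u < n" "u \<in> parents p q a" "a \<in> parents p q u" by (auto simp: W_def)
    then show False using less[of u a] less[of a u] a by simp
  qed
qed

lemma degree_ordered_edges:
  assumes "construction_order n p q" "inj_on h {..<n}" "a < n"
  shows "degree (ordered_edges n p q h) (h a) =
    card (parents p q a) + card {w. w < n \<and> a \<in> parents p q w}"
proof -
  have "degree (ordered_edges n p q h) (h a) =
      card (parents p q a \<union> {w. w < n \<and> a \<in> parents p q w})"
    unfolding degree_def incident_edges_ordered_edges(1)[OF assms]
    by (rule card_image[OF incident_edges_ordered_edges(2)[OF assms]])
  also have "\<dots> = card (parents p q a) + card {w. w < n \<and> a \<in> parents p q w}"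
    by (rule card_Un_disjoint[OF _ _ incident_edges_ordered_edges(3)[OF assms]])
      (auto simp: parents_def)
  finally show ?thesis .
qed

context ordered_two_tree
begin

lemma improper_coloring_of_order:
  fixes h :: "nat \<Rightarrow> 'a"
  assumes h: "inj_on h {..<n}"
  shows "\<exists>c. improper_interval_coloring K (h ` {..<n}) (ordered_edges n p q h) c"
proof -
  let ?E = "ordered_edges n p q h"
  obtain c where c: "\<And>a. a < n \<Longrightarrow> completed c a" using all_completed by blast
  \<comment> \<open>An edge is mapped back to the numbers of its ends, the smaller one being the vertex whose processing
    colored it.\<close>
  define ends where "ends e = {i. i < n \<and> h i \<in> e}" for e
  define col where "col e = c (Min (ends e)) (Max (ends e))" for e
  have col: "col {h u, h w} = c u w" if "u < w" "w < n" for u w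
  proof -
    have "ends {h u, h w} = {u, w}" using that h by (auto simp: ends_def inj_on_def)
    then show ?thesis using that by (simp add: col_def)
  qed
  have main: "integral_interval (col ` incident_edges ?E (h a)) \<and>
      card {e \<in> incident_edges ?E (h a). col e = t} \<le> K" if a: "a < n" for a t
  proof -
    define F where "F u = {h a, h u}" for u
    have nbr: "u < n \<and> u \<noteq> a" if "u \<in> parents p q a \<union> later a" for u
      using that a parent_less[of u a] later_greater[of u a] by (auto simp: later_iff)
    have inc: "incident_edges ?E (h a) = F ` (parents p q a \<union> later a)"
      using incident_edges_ordered_edges(1)[OF order h a] by (simp add: F_def later_def)
    have colF: "col (F u) = (if u < a then c u a else c a u)" if "u \<in> parents p q a \<union> later a" for u
      using nbr[OF that] col[of u a] col[of a u] a by (auto simp: F_def insert_commute)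
    have par: "u < a" if "u \<in> parents p q a" for u using that a parent_less by blast
    have fw: "\<not> u < a" if "u \<in> later a" for u using that later_greater by fastforce
    have img: "col ` incident_edges ?E (h a) = (\<lambda>u. c u a) ` parents p q a \<union> c a ` later a"
    proof -
      have "(\<lambda>u. col (F u)) ` parents p q a = (\<lambda>u. c u a) ` parents p q a"
        using colF par by (intro image_cong) auto
      moreover have "(\<lambda>u. col (F u)) ` later a = c a ` later a"
        using colF fw by (intro image_cong) auto
      ultimately show ?thesis unfolding inc by (simp add: image_Un image_image)
    qed
    have range: "col ` incident_edges ?E (h a) \<subseteq> {1, 2, 3}"
    proof -
      have "c u a \<in> {1, 2, 3}" if "u \<in> parents p q a" for u
        using parent_color[OF _ a that, of c] c a by auto
      moreover have "c a w \<in> {1, 2, 3}" if "w \<in> later a" for w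
        using c[OF a] that unfolding completed_def by blast
      ultimately show ?thesis unfolding img by blast
    qed
    have "integral_interval (col ` incident_edges ?E (h a))"
    proof (cases "later a = {}")
      case False
      then have "2 \<in> col ` incident_edges ?E (h a)"
        using c[OF a] unfolding completed_def img by (simp add: Un_commute)
      then show ?thesis using range by (intro integral_interval_small)
    next
      case True
      \<comment> \<open>Without later neighbors, color 2 may be missing at \<open>a\<close>, but the colors of its at most two edges are near.\<close>
      have near: "near (c (q a) a) (c (p a) a)" if "a \<noteq> 0"
      proof (cases "a = 1")
        case True
        then show ?thesis using order by (simp add: construction_order_def near_def)
      next
        case False
        then show ?thesis using parents_near[of a c] c a that by simp
      qed
      have "\<not> (1 \<in> col ` incident_edges ?E (h a) \<and> 3 \<in> col ` incident_edges ?E (h a))"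
        using near unfolding img True by (auto simp: parents_def near_def)
      then show ?thesis using range by (intro integral_interval_small) auto
    qed
    moreover have "card {e \<in> incident_edges ?E (h a). col e = t} \<le> K"
    proof (cases "t \<in> {1, 2, 3}")
      case False
      then have none: "{e \<in> incident_edges ?E (h a). col e = t} = {}" using range by auto
      show ?thesis unfolding none by simp
    next
      case True
      have "{e \<in> incident_edges ?E (h a). col e = t} =
          F ` ({u \<in> parents p q a. c u a = t} \<union> {w \<in> later a. c a w = t})"
        unfolding inc using colF par fw by auto
      then have "card {e \<in> incident_edges ?E (h a). col e = t} \<le>
          card ({u \<in> parents p q a. c u a = t} \<union> {w \<in> later a. c a w = t})"
        using finite_parents finite_later by (simp add: card_image_le)
      also have "\<dots> \<le> card {u \<in> parents p q a. c u a = t} + card {w \<in> later a. c a w = t}"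
        by (rule card_Un_le)
      also have "card {w \<in> later a. c a w = t} + card {u \<in> parents p q a. c u a = t} \<le> K"
        using c[OF a] True unfolding completed_def by blast
      then have "card {u \<in> parents p q a. c u a = t} + card {w \<in> later a. c a w = t} \<le> K" by simp
      finally show ?thesis .
    qed
    ultimately show ?thesis ..
  qed
  then have "improper_interval_coloring K (h ` {..<n}) ?E col"
    unfolding improper_interval_coloring_def interval_coloring_def by blast
  then show ?thesis by blast
qed

end

section \<open>Maximum degree three\<close>

text \<open>For \<open>\<Delta> = 3\<close> the bound is 1 and asks for a proper coloring, to which the argument for \<open>K \<ge> 2\<close> does not
apply.\<close>

definition diamond :: "'a set \<Rightarrow> 'a set set \<Rightarrow> bool" where
  "diamond V E \<longleftrightarrow> (\<exists>a b c d. distinct [a, b, c, d] \<and> V = {a, b, c, d} \<and>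
     E = {{a, b}, {a, c}, {b, c}, {a, d}, {b, d}})"

lemma four_edges_degree:
  assumes "finite E" "{x, y1} \<in> E" "{x, y2} \<in> E" "{x, y3} \<in> E" "{x, y4} \<in> E"
    "distinct [x, y1, y2, y3, y4]"
  shows "4 \<le> degree E x"
proof -
  have "card {{x, y1}, {x, y2}, {x, y3}, {x, y4}} = 4"
    using assms(6) by (simp add: doubleton_eq_iff)
  moreover have "{{x, y1}, {x, y2}, {x, y3}, {x, y4}} \<subseteq> incident_edges E x"
    using assms by (auto simp: incident_edges_def)
  moreover have "finite (incident_edges E x)" using assms(1) by (simp add: incident_edges_def)
  ultimately show ?thesis unfolding degree_def by (metis card_mono)
qed

text \<open>Every edge of the diamond meets one of its two vertices of degree 3, so attaching a vertex to an edge creates a vertex of degree 4.\<close>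

lemma small_two_trees:
  assumes "two_tree V E"
  shows "(\<exists>a b c. distinct [a, b, c] \<and> V = {a, b, c} \<and> E = {{a, b}, {b, c}, {a, c}}) \<or>
    diamond V E \<or> (\<exists>v\<in>V. 4 \<le> degree E v)"
  using assms
proof induction
  case (triangle a b c)
  then show ?case by blast
next
  case (extend V E a b v)
  have fin: "finite (E \<union> {{v, a}, {v, b}})"
    using simple_graph_finite_edges[OF two_tree_simple_graph[OF extend.hyps(1)]] by simp
  from extend.IH consider
    (tri) x y z where "distinct [x, y, z]" "V = {x, y, z}" "E = {{x, y}, {y, z}, {x, z}}"
    | (dia) x y z w where "distinct [x, y, z, w]" "V = {x, y, z, w}"
        "E = {{x, y}, {x, z}, {y, z}, {x, w}, {y, w}}"
    | (deg) u where "u \<in> V" "4 \<le> degree E u"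
    unfolding diamond_def by blast
  then show ?case
  proof cases
    case tri
    obtain c where c: "distinct [a, b, c]" "V = {a, b, c}" "E = {{a, b}, {a, c}, {b, c}}"
    proof -
      have "{a, b} = {x, y} \<or> {a, b} = {y, z} \<or> {a, b} = {x, z}"
        using extend.hyps(2) tri(3) by simp
      then have "\<exists>c. distinct [a, b, c] \<and> V = {a, b, c} \<and> E = {{a, b}, {a, c}, {b, c}}"
      proof (elim disjE)
        assume "{a, b} = {x, y}"
        then show ?thesis using tri by (intro exI[of _ z]) (auto simp: doubleton_eq_iff)
      next
        assume "{a, b} = {y, z}"
        then show ?thesis using tri by (intro exI[of _ x]) (auto simp: doubleton_eq_iff)
      next
        assume "{a, b} = {x, z}"
        then show ?thesis using tri by (intro exI[of _ y]) (auto simp: doubleton_eq_iff)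
      qed
      then show thesis using that by blast
    qed
    have "distinct [a, b, c, v]" using c extend.hyps(3) by auto
    moreover have "insert v V = {a, b, c, v}" using c by auto
    moreover have "E \<union> {{v, a}, {v, b}} = {{a, b}, {a, c}, {b, c}, {a, v}, {b, v}}"
      unfolding c(3) by (auto simp: insert_commute)
    ultimately show ?thesis unfolding diamond_def by blast
  next
    case dia
    have v: "v \<noteq> x" "v \<noteq> y" "v \<noteq> z" "v \<noteq> w" using extend.hyps(3) dia by auto
    have "x \<in> {a, b} \<or> y \<in> {a, b}" using extend.hyps(2) dia(3) by auto
    then have "{x, v} \<in> E \<union> {{v, a}, {v, b}} \<or> {y, v} \<in> E \<union> {{v, a}, {v, b}}"
      by (auto simp: insert_commute)
    then show ?thesis
    proof
      assume "{x, v} \<in> E \<union> {{v, a}, {v, b}}"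
      then have "4 \<le> degree (E \<union> {{v, a}, {v, b}}) x"
        using dia v by (intro four_edges_degree[OF fin, of x y z w v]) auto
      then show ?thesis using dia by auto
    next
      assume "{y, v} \<in> E \<union> {{v, a}, {v, b}}"
      then have "4 \<le> degree (E \<union> {{v, a}, {v, b}}) y"
        using dia v by (intro four_edges_degree[OF fin, of y x z w v]) (auto simp: insert_commute)
      then show ?thesis using dia by auto
    qed
  next
    case deg
    have "degree E u \<le> degree (E \<union> {{v, a}, {v, b}}) u"
      using fin unfolding degree_def by (intro card_mono) (auto simp: incident_edges_def)
    then show ?thesis using deg by force
  qed
qed

lemma diamond_proper_coloring:
  assumes "diamond V E"
  shows "\<exists>c. improper_interval_coloring 1 V E c"
proof -
  obtain a b c d where d: "distinct [a, b, c, d]" and V: "V = {a, b, c, d}"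
    and E: "E = {{a, b}, {a, c}, {b, c}, {a, d}, {b, d}}"
    using assms unfolding diamond_def by blast
  define f where "f e = (if e = {a, b} then 1 else if e = {a, c} \<or> e = {b, d} then 2 else (3::nat))" for e
  have f: "f {a, b} = 1" "f {a, c} = 2" "f {b, d} = 2" "f {b, c} = 3" "f {a, d} = 3"
    using d by (auto simp: f_def doubleton_eq_iff)
  have inc: "incident_edges E a = {{a, b}, {a, c}, {a, d}}"
    "incident_edges E b = {{a, b}, {b, d}, {b, c}}"
    "incident_edges E c = {{a, c}, {b, c}}" "incident_edges E d = {{b, d}, {a, d}}"
    using d unfolding E incident_edges_def by auto
  have ints: "{1, 2, 3} = {1..3::nat}" "{2, 3} = {2..3::nat}" by auto
  have "f ` incident_edges E v \<in> {{1, 2, 3}, {2, 3}} \<and> inj_on f (incident_edges E v)" if "v \<in> V" for v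
    using that unfolding V by (auto simp: inc f)
  note 1 = this
  have "integral_interval (f ` incident_edges E v)" if "v \<in> V" for v
    using 1[OF that] ints unfolding integral_interval_def by (metis insertE singletonD)
  moreover have "card {e \<in> incident_edges E v. f e = i} \<le> 1" if "v \<in> V" for v i
  proof -
    have "finite (incident_edges E v)" by (simp add: incident_edges_def E)
    then show ?thesis using 1[OF that] by (auto simp: card_le_Suc0_iff_eq inj_on_def)
  qed
  ultimately have "improper_interval_coloring 1 V E f"
    unfolding improper_interval_coloring_def interval_coloring_def by blast
  then show ?thesis by blast
qed

section \<open>The bound on the impropriety\<close>

lemma degree_triangle:
  assumes "distinct [a, b, c]" "v \<in> {a, b, c}"
  shows "degree {{a, b}, {b, c}, {a, c}} v = 2"
proof -
  let ?E = "{{a, b}, {b, c}, {a, c}}"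
  have "incident_edges ?E a = {{a, b}, {a, c}}" "incident_edges ?E b = {{a, b}, {b, c}}"
    "incident_edges ?E c = {{b, c}, {a, c}}"
    using assms(1) unfolding incident_edges_def by auto
  then show ?thesis using assms by (auto simp: degree_def doubleton_eq_iff)
qed

lemma two_tree_improper_coloring:
  assumes "two_tree V E" "2 \<le> K" "\<And>v. v \<in> V \<Longrightarrow> degree E v \<le> 3 * K"
  shows "\<exists>c. improper_interval_coloring K V E c"
proof -
  obtain n p q h where o: "construction_order n p q" "inj_on h {..<n}" "V = h ` {..<n}"
    "E = ordered_edges n p q h" using two_tree_construction_order[OF assms(1)] by metis
  interpret ordered_two_tree n K p q
  proof
    show "card (parents p q a) + card {w. w < n \<and> a \<in> parents p q w} \<le> 3 * K" if "a < n" for a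
      using assms(3)[of "h a"] degree_ordered_edges[OF o(1,2) that] that o(3,4) by simp
  qed (rule o(1) assms(2))+
  show ?thesis unfolding o(3,4) by (rule improper_coloring_of_order[OF o(2)])
qed

lemma mu_int_le:
  assumes "improper_interval_coloring k V E c" "0 < k"
  shows "mu_int V E \<le> k"
  unfolding mu_int_def using assms by (intro Least_le) blast

theorem theorem12:
  fixes V :: "'a set" and E :: "'a set set"
  assumes "two_tree V E"
    and "max_degree V E \<ge> 3"
  shows "int (mu_int V E) \<le> \<lceil>real (max_degree V E) / 3\<rceil>"
proof -
  let ?D = "max_degree V E"
  have fin: "finite V" using two_tree_simple_graph[OF assms(1)] by (simp add: simple_graph_def)
  have le: "degree E v \<le> ?D" if "v \<in> V" for v
    using fin that by (simp add: max_degree_def)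
  have attained: "?D \<in> degree E ` V"
    unfolding max_degree_def using fin two_tree_nonempty[OF assms(1)] by (intro Max_in) auto
  show ?thesis
  proof (cases "?D = 3")
    case True
    have "diamond V E"
      using small_two_trees[OF assms(1)]
    proof (elim disjE)
      assume "\<exists>a b c. distinct [a, b, c] \<and> V = {a, b, c} \<and> E = {{a, b}, {b, c}, {a, c}}"
      then obtain a b c where "distinct [a, b, c]" "V = {a, b, c}" "E = {{a, b}, {b, c}, {a, c}}"
        by blast
      then have "degree E v = 2" if "v \<in> V" for v using degree_triangle that by metis
      then show ?thesis using attained True by auto
    next
      assume "\<exists>v\<in>V. 4 \<le> degree E v"
      then show ?thesis using le True by force
    qed
    then obtain c where "improper_interval_coloring 1 V E c" using diamond_proper_coloring by blast
    then have "mu_int V E \<le> 1" by (rule mu_int_le) simp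
    then show ?thesis using True by simp
  next
    case False
    define K where "K = nat \<lceil>real ?D / 3\<rceil>"
    have ceil: "\<lceil>real ?D / 3\<rceil> = int K" by (simp add: K_def)
    then have "real ?D / 3 \<le> real K" by linarith
    then have D: "?D \<le> 3 * K" by linarith
    then have K: "2 \<le> K" using False assms(2) by linarith
    obtain c where "improper_interval_coloring K V E c"
      using two_tree_improper_coloring[OF assms(1) K] le D by (meson order_trans)
    then have "mu_int V E \<le> K" by (rule mu_int_le) (use K in simp)
    then show ?thesis using ceil by simp
  qed
qed

end
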